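(* Let $(a_k)_{k\in\mathbb{N}}$ be a sequence in $\mathbb{F}$ with $a_0\ne 0$ and let $\mathbf{E}$ be the associated functional all of whose indeterminates have the same moments, i.e. $\mathbf{E}\,x_i^k=a_k$ for all $i,k\in\mathbb{N}$ and $\mathbf{E}$ is multiplicative over distinct indeterminates. Let $\{p_n(x_0)\mid n\in\mathbb{N}\}$ be an orthogonal polynomial system for $\mathbf{E}\colon\mathbb{F}[x_0]\to\mathbb{F}$ such that, for every $n$, $p_n(x_0)$ has pairwise distinct roots $\zeta_1,\zeta_2,\ldots,\zeta_n\in\mathbb{F}$ (depending on $n$). If $n,N\in\mathbb{P}$ and $p(x_1,x_2,\ldots,x_N)$ is a polynomial over $\mathbb{F}$ of degree at most $2n-1$ in each $x_i$, then $$\mathbf{E}\,p(x_1,x_2,\ldots,x_N)=\sum_{\substack{(i_1,i_2,\ldots,i_N)\\ 1\leq i_k\leq n}}c_{i_1}c_{i_2}\cdots c_{i_N}\,p(\zeta_{i_1},\zeta_{i_2},\ldots,\zeta_{i_N}),$$ where, for $1\le i\le n$, $$c_i=\frac{\mathbf{E}\,\Delta(\zeta_1,\ldots,\zeta_{i-1},x_0,\zeta_{i+1},\ldots,\zeta_n)}{\Delta(\zeta_1,\zeta_2,\ldots,\zeta_n)}.$$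
   Context: $\mathbb{F}$ is a field of characteristic zero; $\mathbb{N}$ and $\mathbb{P}$ are the sets of nonnegative and positive integers; $x_0,x_1,x_2,\ldots$ are independent indeterminates. On $\mathbb{F}[x_0]$, $\mathbf{E}$ is the linear functional $x_0^k\mapsto a_k$; on polynomials in $x_1,\ldots,x_N$ it is the linear functional $\mathbf{E}\,x_1^{k_1}\cdots x_N^{k_N}=a_{k_1}a_{k_2}\cdots a_{k_N}$ (exponents $k_i=0$ contribute a factor $a_0$). An orthogonal polynomial system for $\mathbf{E}\colon\mathbb{F}[x_0]\to\mathbb{F}$ is a set $\{p_n(x_0)\mid n\in\mathbb{N}\}$ of polynomials with $\deg p_n=n$ ($p_0$ a nonzero constant) and $\mathbf{E}\,p_k(x_0)p_n(x_0)=0$ for all $k\ne n$. Vandermonde polynomial: $\Delta(z_1,\ldots,z_n)=\prod_{1\le i<j\le n}(z_j-z_i)$, with $\Delta(z_1)=1$. *)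

theory Defs
  imports "HOL-Computational_Algebra.Polynomial" "HOL-Library.FuncSet" "HOL-Library.Poly_Mapping"
begin

section \<open>Polynomials in several indeterminates\<close>

text \<open>
  A monomial is a finitely supported exponent map \<open>m\<close>, standing for the product of the
  powers \<open>x\<^sub>i ^ Poly_Mapping.lookup m i\<close>; a polynomial is a finitely supported map from
  monomials to coefficients.
\<close>

type_synonym 'a mpoly = "(nat \<Rightarrow>\<^sub>0 nat) \<Rightarrow>\<^sub>0 'a"

definition mpoly_vars :: "'a::zero mpoly \<Rightarrow> nat set" where
  "mpoly_vars P = (\<Union>m\<in>Poly_Mapping.keys P. Poly_Mapping.keys m)"

text \<open>The zero polynomial is given degree 0 in each indeterminate.\<close>

definition mpoly_degree_in :: "'a::zero mpoly \<Rightarrow> nat \<Rightarrow> nat" where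
  "mpoly_degree_in P i = Max (insert 0 ((\<lambda>m. Poly_Mapping.lookup m i) ` Poly_Mapping.keys P))"

definition mpoly_eval :: "'a::comm_semiring_1 mpoly \<Rightarrow> (nat \<Rightarrow> 'a) \<Rightarrow> 'a" where
  "mpoly_eval P z =
     (\<Sum>m\<in>Poly_Mapping.keys P. Poly_Mapping.lookup P m *
        (\<Prod>i\<in>Poly_Mapping.keys m. z i ^ Poly_Mapping.lookup m i))"


section \<open>The moment functional\<close>

definition moment_functional :: "(nat \<Rightarrow> 'a::comm_semiring_1) \<Rightarrow> 'a poly \<Rightarrow> 'a" where
  "moment_functional a q = (\<Sum>k\<le>degree q. coeff q k * a k)"

text \<open>
  The functional on polynomials in \<open>x\<^sub>1, \<dots>, x\<^sub>N\<close>. The product runs over all of \<open>{1..N}\<close>, and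
  not only over the support of the monomial, because an exponent 0 contributes a factor \<open>a 0\<close>;
  hence the dependence on \<open>N\<close>.
\<close>

definition multi_moment_functional ::
    "(nat \<Rightarrow> 'a::comm_semiring_1) \<Rightarrow> nat \<Rightarrow> 'a mpoly \<Rightarrow> 'a" where
  "multi_moment_functional a N P =
     (\<Sum>m\<in>Poly_Mapping.keys P. Poly_Mapping.lookup P m *
        (\<Prod>i\<in>{1..N}. a (Poly_Mapping.lookup m i)))"

lemma moment_functional_altdef:
  assumes "degree q \<le> d"
  shows "moment_functional a q = (\<Sum>k\<le>d. coeff q k * a k)"
  unfolding moment_functional_def using assms
  by (intro sum.mono_neutral_left) (auto simp: coeff_eq_0)

lemma moment_functional_add:
  "moment_functional a (p + q) = moment_functional a p + moment_functional a q"
proof -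
  let ?d = "max (degree p) (degree q)"
  have "degree (p + q) \<le> ?d" by (rule degree_add_le_max)
  then show ?thesis
    by (simp add: moment_functional_altdef[of _ ?d] sum.distrib distrib_right)
qed

lemma moment_functional_smult:
  "moment_functional a (smult c q) = c * moment_functional a q"
  by (subst (1 2) moment_functional_altdef[of _ "degree q"])
     (simp_all add: degree_smult_le sum_distrib_left mult.assoc)

lemma moment_functional_power: "moment_functional a (monom 1 k) = a k"
  by (simp add: moment_functional_altdef[OF degree_monom_le] of_bool_def[symmetric]
      if_distrib[of "\<lambda>x. x * _"] cong: if_cong)

lemma multi_moment_functional_monomial:
  "multi_moment_functional a N (Poly_Mapping.single m c) =
     c * (\<Prod>i\<in>{1..N}. a (Poly_Mapping.lookup m i))"
  by (simp add: multi_moment_functional_def)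

lemma multi_moment_functional_altdef:
  assumes "finite M" "Poly_Mapping.keys P \<subseteq> M"
  shows "multi_moment_functional a N P =
     (\<Sum>m\<in>M. Poly_Mapping.lookup P m * (\<Prod>i\<in>{1..N}. a (Poly_Mapping.lookup m i)))"
  unfolding multi_moment_functional_def using assms
  by (intro sum.mono_neutral_left) (auto simp: in_keys_iff)

lemma multi_moment_functional_add:
  "multi_moment_functional a N (P + Q) =
     multi_moment_functional a N P + multi_moment_functional a N Q"
proof -
  let ?M = "Poly_Mapping.keys P \<union> Poly_Mapping.keys Q"
  have "Poly_Mapping.keys (P + Q) \<subseteq> ?M" by (rule Poly_Mapping.keys_add)
  then show ?thesis
    by (simp add: multi_moment_functional_altdef[of ?M] lookup_add sum.distrib distrib_right)
qed


section \<open>Orthogonal polynomial systems\<close>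

definition orthogonal_system :: "(nat \<Rightarrow> 'a::comm_ring_1) \<Rightarrow> (nat \<Rightarrow> 'a poly) \<Rightarrow> bool" where
  "orthogonal_system a p \<longleftrightarrow>
     (\<forall>n. p n \<noteq> 0 \<and> degree (p n) = n) \<and>
     (\<forall>k n. k \<noteq> n \<longrightarrow> moment_functional a (p k * p n) = 0)"


section \<open>The Vandermonde polynomial\<close>

text \<open>
  The arguments are \<open>z 1, \<dots>, z n\<close>. The ring is arbitrary, so that scalars and constant or
  nonconstant polynomials can both be substituted.
\<close>

definition vandermonde :: "nat \<Rightarrow> (nat \<Rightarrow> 'a::comm_ring_1) \<Rightarrow> 'a" where
  "vandermonde n z = (\<Prod>(i, j)\<in>{(i, j). 1 \<le> i \<and> i < j \<and> j \<le> n}. z j - z i)"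

text \<open>
  The numerator is the functional applied to the Vandermonde polynomial in which the \<open>i\<close>-th
  argument is the indeterminate \<open>[:0, 1:]\<close> and the others are the constants \<open>[:\<zeta> j:]\<close>.
\<close>

definition quadrature_weight ::
    "(nat \<Rightarrow> 'a::field) \<Rightarrow> nat \<Rightarrow> (nat \<Rightarrow> 'a) \<Rightarrow> nat \<Rightarrow> 'a" where
  "quadrature_weight a n \<zeta> i =
     moment_functional a (vandermonde n ((\<lambda>j. [:\<zeta> j:])(i := [:0, 1:]))) / vandermonde n \<zeta>"

end

theory Submission
  imports Defs
begin

text \<open>
  This is Gauss quadrature, carried out in each indeterminate separately.

  In one indeterminate, Lagrange interpolation at \<open>n\<close> distinct nodes reproduces a polynomial of
  degree less than \<open>n\<close> exactly, and the Lagrange basis polynomials are, up to the factor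
  \<open>vandermonde n \<zeta>\<close>, the Vandermonde polynomials with one argument replaced by the indeterminate.
  Applying the functional to the interpolation formula produces the weights
  (\<open>interpolatory_quadrature\<close>). If the nodes are the roots of \<open>p n\<close>, the range of exactness
  doubles: dividing a polynomial of degree at most \<open>2n - 1\<close> by \<open>p n\<close> leaves a quotient and a
  remainder of degree less than \<open>n\<close>. The multiple of \<open>p n\<close> is annihilated by the functional,
  because of orthogonality, and by the quadrature sum, because \<open>p n\<close> vanishes at the nodes; so
  only the remainder counts (\<open>gauss_quadrature\<close>).

  In particular \<open>a k = (\<Sum>i. c\<^sub>i * \<zeta>\<^sub>i ^ k)\<close> for every exponent \<open>k \<le> 2n - 1\<close>. On a monomial
  the multivariate functional is a product of such moments, and expanding the product of
  sums gives the sum over all tuples of nodes.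
\<close>

section \<open>Linearity of the moment functional\<close>

lemma moment_functional_sum:
  "moment_functional a (\<Sum>i\<in>A. f i) = (\<Sum>i\<in>A. moment_functional a (f i))"
proof (induction A rule: infinite_finite_induct)
  case (insert x A)
  then show ?case by (simp add: moment_functional_add)
qed (simp_all add: moment_functional_def)

section \<open>Vandermonde polynomials as Lagrange basis polynomials\<close>

lemma finite_vandermonde_pairs: "finite {(i, j). 1 \<le> i \<and> i < j \<and> j \<le> (n::nat)}"
  by (rule finite_subset[of _ "{1..n} \<times> {1..n}"]) auto

lemma poly_vandermonde: "poly (vandermonde n Z) x = vandermonde n (\<lambda>j. poly (Z j) x)"
  by (simp add: vandermonde_def poly_prod case_prod_beta)

lemma vandermonde_eq_0_iff:
  fixes z :: "nat \<Rightarrow> 'a::idom"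
  shows "vandermonde n z = 0 \<longleftrightarrow> \<not> inj_on z {1..n}"
proof -
  have zero_iff: "vandermonde n z = 0 \<longleftrightarrow> (\<exists>i j. 1 \<le> i \<and> i < j \<and> j \<le> n \<and> z j = z i)"
    unfolding vandermonde_def prod_zero_iff[OF finite_vandermonde_pairs]
    by (simp add: Bex_def)
  show ?thesis
  proof
    assume "vandermonde n z = 0"
    then obtain i j where "1 \<le> i" "i < j" "j \<le> n" "z j = z i"
      unfolding zero_iff by blast
    then show "\<not> inj_on z {1..n}"
      using inj_onD[of z "{1..n}" j i] by auto
  next
    assume "\<not> inj_on z {1..n}"
    then obtain i j where "i \<in> {1..n}" "j \<in> {1..n}" "i < j" "z i = z j"
      by (metis linorder_inj_onI')
    then have "1 \<le> i \<and> i < j \<and> j \<le> n \<and> z j = z i"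
      by simp
    then show "vandermonde n z = 0"
      unfolding zero_iff by blast
  qed
qed

abbreviation vandermonde_at :: "nat \<Rightarrow> (nat \<Rightarrow> 'a::comm_ring_1) \<Rightarrow> nat \<Rightarrow> 'a poly" where
  "vandermonde_at n \<zeta> i \<equiv> vandermonde n ((\<lambda>j. [:\<zeta> j:])(i := [:0, 1:]))"

lemma poly_vandermonde_at: "poly (vandermonde_at n \<zeta> i) x = vandermonde n (\<zeta>(i := x))"
  by (simp add: poly_vandermonde fun_upd_def if_distrib[of "\<lambda>q. poly q x"] cong: if_cong)

text \<open>
  Up to normalisation these are the Lagrange basis polynomials: at a node other than the
  \<open>i\<close>-th, two arguments of the Vandermonde polynomial coincide.
\<close>

lemma poly_vandermonde_at_node:
  fixes \<zeta> :: "nat \<Rightarrow> 'a::idom"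
  assumes "i \<in> {1..n}" "j \<in> {1..n}"
  shows "poly (vandermonde_at n \<zeta> i) (\<zeta> j) = (if j = i then vandermonde n \<zeta> else 0)"
proof (cases "j = i")
  case False
  have "\<not> inj_on (\<zeta>(i := \<zeta> j)) {1..n}"
    using inj_onD[of "\<zeta>(i := \<zeta> j)" "{1..n}" i j] assms False by auto
  with False show ?thesis
    by (simp add: poly_vandermonde_at vandermonde_eq_0_iff)
qed (simp add: poly_vandermonde_at)

text \<open>
  Only the factors whose index pair contains \<open>i\<close> involve the indeterminate, and such a pair is
  determined by its other member.
\<close>

lemma degree_vandermonde_at:
  fixes \<zeta> :: "nat \<Rightarrow> 'a::idom"
  assumes "i \<in> {1..n}"
  shows "degree (vandermonde_at n \<zeta> i) < n"
proof -
  let ?S = "{(k, l). 1 \<le> k \<and> k < l \<and> l \<le> n}"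
  let ?T = "{(k, l) \<in> ?S. k = i \<or> l = i}"
  let ?Z = "(\<lambda>j. [:\<zeta> j:])(i := [:0, 1:])"
  have "degree (vandermonde_at n \<zeta> i) \<le> (\<Sum>s\<in>?S. degree (case s of (k, l) \<Rightarrow> ?Z l - ?Z k))"
    unfolding vandermonde_def using degree_prod_sum_le[OF finite_vandermonde_pairs]
    by (simp add: o_def)
  also have "\<dots> \<le> (\<Sum>s\<in>?S. if s \<in> ?T then 1 else 0)"
    by (intro sum_mono) (auto split: if_splits)
  also have "\<dots> = card ?T"
    using finite_vandermonde_pairs[of n]
    by (simp add: sum.If_cases) (rule arg_cong[where f = card], auto)
  also have "\<dots> \<le> card ({1..n} - {i})"
    by (rule card_inj_on_le[of "\<lambda>(k, l). if k = i then l else k"])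
      (use assms in \<open>auto simp: inj_on_def split: if_splits\<close>)
  also have "\<dots> < n"
    using assms by auto
  finally show ?thesis .
qed

section \<open>Quadrature in one indeterminate\<close>

text \<open>
  Two polynomials of degree less than \<open>n\<close> that agree at \<open>n\<close> nodes are equal. Stated without
  division, so that the functional can be applied to both sides directly.
\<close>

lemma vandermonde_interpolation:
  fixes \<zeta> :: "nat \<Rightarrow> 'a::idom"
  assumes inj: "inj_on \<zeta> {1..n}" and deg: "degree q < n"
  shows "smult (vandermonde n \<zeta>) q =
    (\<Sum>i\<in>{1..n}. smult (poly q (\<zeta> i)) (vandermonde_at n \<zeta> i))" (is "?L = ?R")
proof (rule poly_eqI_degree)
  show "poly ?L x = poly ?R x" if "x \<in> \<zeta> ` {1..n}" for x
  proof -
    from that obtain j where j: "j \<in> {1..n}" "x = \<zeta> j" by auto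
    have "poly ?R x = (\<Sum>i\<in>{1..n}. if i = j then poly q (\<zeta> j) * vandermonde n \<zeta> else 0)"
      unfolding poly_sum using j
      by (intro sum.cong) (auto simp: poly_vandermonde_at_node)
    with j show ?thesis by (simp add: mult.commute)
  qed
  have card: "card (\<zeta> ` {1..n}) = n"
    using inj by (simp add: card_image)
  show "degree ?L < card (\<zeta> ` {1..n})"
    unfolding card using deg by (meson degree_smult_le le_less_trans)
  have "degree ?R \<le> n - 1"
  proof (rule degree_sum_le)
    fix i assume "i \<in> {1..n}"
    then have "degree (vandermonde_at n \<zeta> i) < n" by (rule degree_vandermonde_at)
    then show "degree (smult (poly q (\<zeta> i)) (vandermonde_at n \<zeta> i)) \<le> n - 1"
      by (intro order_trans[OF degree_smult_le]) simp
  qed simp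
  then show "degree ?R < card (\<zeta> ` {1..n})"
    unfolding card using deg by linarith
qed

lemma interpolatory_quadrature:
  assumes "inj_on \<zeta> {1..n}" and "degree q < n"
  shows "moment_functional a q = (\<Sum>i\<in>{1..n}. quadrature_weight a n \<zeta> i * poly q (\<zeta> i))"
proof -
  have nz: "vandermonde n \<zeta> \<noteq> 0"
    using assms(1) by (simp add: vandermonde_eq_0_iff)
  have "vandermonde n \<zeta> * moment_functional a q =
      (\<Sum>i\<in>{1..n}. poly q (\<zeta> i) * moment_functional a (vandermonde_at n \<zeta> i))"
    using arg_cong[OF vandermonde_interpolation[OF assms], of "moment_functional a"]
    by (simp add: moment_functional_smult moment_functional_sum)
  also have "\<dots> = vandermonde n \<zeta> * (\<Sum>i\<in>{1..n}. quadrature_weight a n \<zeta> i * poly q (\<zeta> i))"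
    using nz unfolding sum_distrib_left
    by (intro sum.cong) (simp_all add: quadrature_weight_def)
  finally show ?thesis
    using nz by simp
qed

text \<open>
  The polynomials \<open>p 0, \<dots>, p (n - 1)\<close> span the polynomials of degree less than \<open>n\<close>; the induction
  on the degree removes the leading term of \<open>q\<close> with a multiple of \<open>p (degree q)\<close>.
\<close>

lemma orthogonal_system_lower_degree:
  fixes a :: "nat \<Rightarrow> 'a::field"
  assumes orth: "orthogonal_system a p" and "degree q < n"
  shows "moment_functional a (q * p n) = 0"
  using assms(2)
proof (induction "degree q" arbitrary: q rule: less_induct)
  case less
  define d where "d = degree q"
  define c where "c = lead_coeff q / lead_coeff (p d)"
  define r where "r = q - smult c (p d)"
  have pd: "p d \<noteq> 0" "degree (p d) = d"
    using orth by (auto simp: orthogonal_system_def)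
  have lead: "coeff (p d) d \<noteq> 0"
    using pd by (metis leading_coeff_0_iff)
  have r0: "moment_functional a (r * p n) = 0"
  proof (cases "d = 0")
    case True
    \<comment> \<open>The degree cannot drop below 0, but here the remainder is 0 itself.\<close>
    then obtain u v where "q = [:u:]" "p d = [:v:]"
      using pd by (metis d_def degree_eq_zeroE)
    with pd(1) have "r = 0" by (simp add: r_def c_def)
    then show ?thesis by (simp add: moment_functional_def)
  next
    case False
    have "coeff r d = 0"
      using pd(2) lead by (simp add: r_def c_def d_def[symmetric])
    moreover have "degree r \<le> d"
      unfolding r_def using pd(2) degree_smult_le[of c "p d"]
      by (intro degree_diff_le) (auto simp: d_def)
    ultimately have "degree r < d"
      using False by (metis eq_zero_or_degree_less degree_0 neq0_conv)
    then show ?thesis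
      using less by (simp add: d_def)
  qed
  have "q * p n = r * p n + smult c (p d * p n)"
    by (simp add: r_def algebra_simps)
  then have "moment_functional a (q * p n) = c * moment_functional a (p d * p n)"
    by (simp add: moment_functional_add moment_functional_smult r0)
  also have "\<dots> = 0"
    using orth less.prems by (simp add: orthogonal_system_def d_def)
  finally show ?case .
qed

lemma gauss_quadrature:
  assumes orth: "orthogonal_system a p"
    and inj: "inj_on \<zeta> {1..n}"
    and roots: "\<And>i. i \<in> {1..n} \<Longrightarrow> poly (p n) (\<zeta> i) = 0"
    and deg: "degree f < 2 * n"
  shows "moment_functional a f = (\<Sum>i\<in>{1..n}. quadrature_weight a n \<zeta> i * poly f (\<zeta> i))"
proof -
  define s where "s = f div p n"
  define r where "r = f mod p n"
  have pn: "p n \<noteq> 0" "degree (p n) = n"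
    using orth by (auto simp: orthogonal_system_def)
  have f: "f = s * p n + r"
    by (simp add: s_def r_def)
  have n: "n > 0"
    using deg by simp
  have degr: "degree r < n"
    using degree_mod_less[OF pn(1), of f] n pn(2) by (auto simp: r_def)
  have degs: "degree s < n"
  proof (cases "s = 0")
    case False
    have "degree s + n = degree (f - r)"
      using degree_mult_eq[OF False pn(1)] pn(2) f by simp
    also have "\<dots> < 2 * n"
      using deg degr by (intro degree_diff_less) auto
    finally show ?thesis by simp
  qed (use n in simp)
  have "moment_functional a f = moment_functional a r"
    by (subst f) (simp add: moment_functional_add orthogonal_system_lower_degree[OF orth degs])
  also have "\<dots> = (\<Sum>i\<in>{1..n}. quadrature_weight a n \<zeta> i * poly r (\<zeta> i))"
    by (rule interpolatory_quadrature[OF inj degr])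
  also have "\<dots> = (\<Sum>i\<in>{1..n}. quadrature_weight a n \<zeta> i * poly f (\<zeta> i))"
    by (intro sum.cong) (simp_all add: f roots)
  finally show ?thesis .
qed

section \<open>Quadrature in several indeterminates\<close>

lemma lookup_le_mpoly_degree_in:
  assumes "m \<in> Poly_Mapping.keys P"
  shows "Poly_Mapping.lookup m i \<le> mpoly_degree_in P i"
  unfolding mpoly_degree_in_def using assms by (intro Max_ge) auto

lemma mpoly_eval_altdef:
  assumes "mpoly_vars P \<subseteq> A" and "finite A"
  shows "mpoly_eval P z =
    (\<Sum>m\<in>Poly_Mapping.keys P. Poly_Mapping.lookup P m * (\<Prod>i\<in>A. z i ^ Poly_Mapping.lookup m i))"
  unfolding mpoly_eval_def
proof (intro sum.cong refl arg_cong2[where f = "(*)"])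
  fix m assume "m \<in> Poly_Mapping.keys P"
  then have "Poly_Mapping.keys m \<subseteq> A"
    using assms(1) by (auto simp: mpoly_vars_def)
  then show "(\<Prod>i\<in>Poly_Mapping.keys m. z i ^ Poly_Mapping.lookup m i) =
      (\<Prod>i\<in>A. z i ^ Poly_Mapping.lookup m i)"
    using assms(2) by (intro prod.mono_neutral_left) (auto simp: in_keys_iff)
qed

theorem theorem8:
  fixes a :: "nat \<Rightarrow> 'a::field_char_0"
    and p :: "nat \<Rightarrow> 'a poly"
    and \<zeta> :: "nat \<Rightarrow> nat \<Rightarrow> 'a"
    and n N :: nat
    and P :: "'a mpoly"
  assumes "a 0 \<noteq> 0"
    and "orthogonal_system a p"
    and "\<And>m. inj_on (\<zeta> m) {1..m}"
    and "\<And>m i. i \<in> {1..m} \<Longrightarrow> poly (p m) (\<zeta> m i) = 0"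
    and "n \<ge> 1" and "N \<ge> 1"
    and "mpoly_vars P \<subseteq> {1..N}"
    and "\<And>i. i \<in> {1..N} \<Longrightarrow> mpoly_degree_in P i \<le> 2 * n - 1"
  shows "multi_moment_functional a N P =
    (\<Sum>I\<in>{1..N} \<rightarrow>\<^sub>E {1..n}.
       (\<Prod>k\<in>{1..N}. quadrature_weight a n (\<zeta> n) (I k)) * mpoly_eval P (\<lambda>k. \<zeta> n (I k)))"
proof -
  let ?c = "quadrature_weight a n (\<zeta> n)"
  have moment: "a k = (\<Sum>j\<in>{1..n}. ?c j * \<zeta> n j ^ k)" if "k \<le> 2 * n - 1" for k
  proof -
    have "degree (monom (1::'a) k) < 2 * n"
      using that assms(5) by (simp add: degree_monom_eq)
    from gauss_quadrature[OF assms(2,3,4) this] show ?thesis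
      by (simp add: moment_functional_power poly_monom)
  qed
  have monomial: "(\<Prod>i\<in>{1..N}. a (Poly_Mapping.lookup m i)) =
      (\<Sum>I\<in>{1..N} \<rightarrow>\<^sub>E {1..n}.
        (\<Prod>k\<in>{1..N}. ?c (I k)) * (\<Prod>k\<in>{1..N}. \<zeta> n (I k) ^ Poly_Mapping.lookup m k))"
    if m: "m \<in> Poly_Mapping.keys P" for m
  proof -
    have "(\<Prod>i\<in>{1..N}. a (Poly_Mapping.lookup m i)) =
        (\<Prod>i\<in>{1..N}. \<Sum>j\<in>{1..n}. ?c j * \<zeta> n j ^ Poly_Mapping.lookup m i)"
      using order_trans[OF lookup_le_mpoly_degree_in[OF m] assms(8)]
      by (intro prod.cong refl moment)
    also have "\<dots> = (\<Sum>I\<in>{1..N} \<rightarrow>\<^sub>E {1..n}.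
        \<Prod>k\<in>{1..N}. ?c (I k) * \<zeta> n (I k) ^ Poly_Mapping.lookup m k)"
      by (rule prod_sum_PiE) auto
    finally show ?thesis
      by (simp add: prod.distrib)
  qed
  have "multi_moment_functional a N P =
      (\<Sum>m\<in>Poly_Mapping.keys P. \<Sum>I\<in>{1..N} \<rightarrow>\<^sub>E {1..n}. Poly_Mapping.lookup P m *
        ((\<Prod>k\<in>{1..N}. ?c (I k)) * (\<Prod>k\<in>{1..N}. \<zeta> n (I k) ^ Poly_Mapping.lookup m k)))"
    unfolding multi_moment_functional_def sum_distrib_left[symmetric]
    by (intro sum.cong refl arg_cong2[where f = "(*)"] monomial)
  also have "\<dots> = (\<Sum>I\<in>{1..N} \<rightarrow>\<^sub>E {1..n}. (\<Prod>k\<in>{1..N}. ?c (I k)) *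
      (\<Sum>m\<in>Poly_Mapping.keys P. Poly_Mapping.lookup P m *
        (\<Prod>k\<in>{1..N}. \<zeta> n (I k) ^ Poly_Mapping.lookup m k)))"
    by (subst sum.swap) (simp add: sum_distrib_left mult.left_commute)
  finally show ?thesis
    by (simp add: mpoly_eval_altdef[OF assms(7)])
qed

end
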